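(* Let $I$ be a non-empty set, $(A_i)_{i\in I}$ a family of abelian groups, $X=\bigcup_{i\in I}A_i$ their disjoint union, and let $c_{i,j},d_{i,j}\in A_j$ for $i,j\in I$ be arbitrary constants. Define, for $x\in A_i$ and $y\in A_j$, $\sigma_x(y)=y+c_{i,j}$ and $\tau_y(x)=x+d_{j,i}$. Then $(X,\sigma,\tau)$ is a $2$-reductive solution.
   Context: A solution is a triple $(X,\sigma,\tau)$ with $X$ a non-empty set and bijections $\sigma_x,\tau_y$ of $X$ ($x,y\in X$) such that $r(x,y)=(\sigma_x(y),\tau_y(x))$ is a bijection of $X^2$ satisfying $(\mathrm{id}\times r)(r\times\mathrm{id})(\mathrm{id}\times r)=(r\times\mathrm{id})(\mathrm{id}\times r)(r\times\mathrm{id})$ on $X^3$. It is $2$-reductive if for all $x,y\in X$: $\sigma_{\sigma_x(y)}=\sigma_y$, $\tau_{\tau_x(y)}=\tau_y$, $\sigma_{\tau_x(y)}=\sigma_y$, $\tau_{\sigma_x(y)}=\tau_y$. *)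

theory Defs
  imports "HOL-Algebra.Group"
begin

text \<open>
  \<open>\<sigma> x\<close> and \<open>\<tau> y\<close> are maps of the carrier set \<open>X\<close>; their values outside \<open>X\<close> are irrelevant.
  The argument order is that of the subscripts, so the value of \<open>\<tau>\<^sub>y\<close> at \<open>x\<close> is \<open>\<tau> y x\<close>.
\<close>

definition ybe_map :: "('x \<Rightarrow> 'x \<Rightarrow> 'x) \<Rightarrow> ('x \<Rightarrow> 'x \<Rightarrow> 'x) \<Rightarrow> 'x \<times> 'x \<Rightarrow> 'x \<times> 'x" where
  "ybe_map \<sigma> \<tau> = (\<lambda>(x, y). (\<sigma> x y, \<tau> y x))"

definition times_id :: "('x \<times> 'x \<Rightarrow> 'x \<times> 'x) \<Rightarrow> 'x \<times> 'x \<times> 'x \<Rightarrow> 'x \<times> 'x \<times> 'x" where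
  "times_id r = (\<lambda>(x, y, z). (fst (r (x, y)), snd (r (x, y)), z))"

definition id_times :: "('x \<times> 'x \<Rightarrow> 'x \<times> 'x) \<Rightarrow> 'x \<times> 'x \<times> 'x \<Rightarrow> 'x \<times> 'x \<times> 'x" where
  "id_times r = (\<lambda>(x, y, z). (x, r (y, z)))"

definition solution :: "'x set \<Rightarrow> ('x \<Rightarrow> 'x \<Rightarrow> 'x) \<Rightarrow> ('x \<Rightarrow> 'x \<Rightarrow> 'x) \<Rightarrow> bool" where
  "solution X \<sigma> \<tau> \<longleftrightarrow>
     X \<noteq> {} \<and>
     (\<forall>x\<in>X. bij_betw (\<sigma> x) X X) \<and>
     (\<forall>y\<in>X. bij_betw (\<tau> y) X X) \<and>
     bij_betw (ybe_map \<sigma> \<tau>) (X \<times> X) (X \<times> X) \<and>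
     (let r = ybe_map \<sigma> \<tau> in
        \<forall>t \<in> X \<times> X \<times> X.
          (id_times r \<circ> times_id r \<circ> id_times r) t = (times_id r \<circ> id_times r \<circ> times_id r) t)"

text \<open>Equality of two of the maps \<open>\<sigma> x\<close>, \<open>\<tau> y\<close> means equality as maps on \<open>X\<close>.\<close>

definition two_reductive :: "'x set \<Rightarrow> ('x \<Rightarrow> 'x \<Rightarrow> 'x) \<Rightarrow> ('x \<Rightarrow> 'x \<Rightarrow> 'x) \<Rightarrow> bool" where
  "two_reductive X \<sigma> \<tau> \<longleftrightarrow>
     (\<forall>x\<in>X. \<forall>y\<in>X. \<forall>z\<in>X.
        \<sigma> (\<sigma> x y) z = \<sigma> y z \<and>
        \<tau> (\<tau> x y) z = \<tau> y z \<and>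
        \<sigma> (\<tau> x y) z = \<sigma> y z \<and>
        \<tau> (\<sigma> x y) z = \<tau> y z)"

text \<open>
  The disjoint union is tagged: \<open>(i, a)\<close> is the element \<open>a\<close> of \<open>A i\<close>. The abelian groups are
  written multiplicatively, so \<open>y + c\<^bsub>i,j\<^esub>\<close> becomes \<open>y \<otimes>\<^bsub>A j\<^esub> c i j\<close>.
\<close>

definition union_carrier :: "'i set \<Rightarrow> ('i \<Rightarrow> 'a monoid) \<Rightarrow> ('i \<times> 'a) set" where
  "union_carrier I A = (SIGMA i:I. carrier (A i))"

definition union_sigma ::
  "('i \<Rightarrow> 'a monoid) \<Rightarrow> ('i \<Rightarrow> 'i \<Rightarrow> 'a) \<Rightarrow> 'i \<times> 'a \<Rightarrow> 'i \<times> 'a \<Rightarrow> 'i \<times> 'a" where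
  "union_sigma A c = (\<lambda>(i, x) (j, y). (j, y \<otimes>\<^bsub>A j\<^esub> c i j))"

definition union_tau ::
  "('i \<Rightarrow> 'a monoid) \<Rightarrow> ('i \<Rightarrow> 'i \<Rightarrow> 'a) \<Rightarrow> 'i \<times> 'a \<Rightarrow> 'i \<times> 'a \<Rightarrow> 'i \<times> 'a" where
  "union_tau A d = (\<lambda>(j, y) (i, x). (i, x \<otimes>\<^bsub>A i\<^esub> d j i))"

end

theory Submission imports Defs begin

text \<open>The maps \<open>\<sigma> x\<close> and \<open>\<tau> x\<close> depend only on the index
  of \<open>x\<close>, and all of them preserve the index of their argument while translating inside
  its group. Replacing a subscript by its image thus changes nothing, which is 2-reductivity. In the
  braid relation each side reverses the three fibres and translates each entry by the same two
  constants, possibly in opposite order, so it holds because the groups are abelian. Bijectivity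
  comes from inverting translations.\<close>

lemma bij_betw_fibrewise_translation:
  assumes "\<And>i. i \<in> I \<Longrightarrow> group (A i)"
    and "\<And>i. i \<in> I \<Longrightarrow> g i \<in> carrier (A i)"
  shows "bij_betw (\<lambda>(i, x). (i, x \<otimes>\<^bsub>A i\<^esub> g i)) (union_carrier I A) (union_carrier I A)"
  by (rule bij_betw_byWitness[where f' = "\<lambda>(i, x). (i, x \<otimes>\<^bsub>A i\<^esub> inv\<^bsub>A i\<^esub> g i)"])
    (use assms in \<open>auto simp: union_carrier_def group.is_monoid monoid.m_assoc
        group.r_inv group.l_inv monoid.m_closed\<close>)

lemma bij_betw_union_sigma:
  assumes "\<And>i. i \<in> I \<Longrightarrow> group (A i)"
    and "\<And>i j. i \<in> I \<Longrightarrow> j \<in> I \<Longrightarrow> c i j \<in> carrier (A j)"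
    and "x \<in> union_carrier I A"
  shows "bij_betw (union_sigma A c x) (union_carrier I A) (union_carrier I A)"
  using assms bij_betw_fibrewise_translation[of I A "c (fst x)"]
  by (cases x) (auto simp: union_sigma_def union_carrier_def)

text \<open>With arguments ordered as the subscripts, both are the same operator on a family of
  constants, so bijectivity of \<open>\<tau> y\<close> is an instance of that of
  \<open>\<sigma> x\<close>.\<close>

lemma union_tau_eq_union_sigma: "union_tau = union_sigma"
  by (simp add: union_tau_def union_sigma_def fun_eq_iff)

lemma bij_betw_ybe_map_union:
  assumes "\<And>i. i \<in> I \<Longrightarrow> group (A i)"
    and "\<And>i j. i \<in> I \<Longrightarrow> j \<in> I \<Longrightarrow> c i j \<in> carrier (A j)"
    and "\<And>i j. i \<in> I \<Longrightarrow> j \<in> I \<Longrightarrow> d i j \<in> carrier (A j)"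
  defines "X \<equiv> union_carrier I A"
  shows "bij_betw (ybe_map (union_sigma A c) (union_tau A d)) (X \<times> X) (X \<times> X)"
  \<comment> \<open>The map \<open>r\<close> swaps the fibres but keeps both indices readable, so
    the inverse swaps back and subtracts the same constants.\<close>
  by (rule bij_betw_byWitness[where f' = "\<lambda>((j, y), (i, x)).
        ((i, x \<otimes>\<^bsub>A i\<^esub> inv\<^bsub>A i\<^esub> d j i), (j, y \<otimes>\<^bsub>A j\<^esub> inv\<^bsub>A j\<^esub> c i j))"])
    (use assms in \<open>auto simp: X_def union_carrier_def ybe_map_def union_sigma_def union_tau_def
        group.is_monoid monoid.m_assoc group.r_inv group.l_inv monoid.m_closed\<close>)

theorem theorem3p7:
  fixes I :: "'i set"
    and A :: "'i \<Rightarrow> 'a monoid"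
    and c d :: "'i \<Rightarrow> 'i \<Rightarrow> 'a"
  assumes "I \<noteq> {}"
    and "\<And>i. i \<in> I \<Longrightarrow> comm_group (A i)"
    and "\<And>i j. i \<in> I \<Longrightarrow> j \<in> I \<Longrightarrow> c i j \<in> carrier (A j)"
    and "\<And>i j. i \<in> I \<Longrightarrow> j \<in> I \<Longrightarrow> d i j \<in> carrier (A j)"
  shows "solution (union_carrier I A) (union_sigma A c) (union_tau A d) \<and>
         two_reductive (union_carrier I A) (union_sigma A c) (union_tau A d)"
proof
  let ?X = "union_carrier I A"
  let ?r = "ybe_map (union_sigma A c) (union_tau A d)"
  have grp: "group (A i)" if "i \<in> I" for i
    using assms(2)[OF that] by (simp add: comm_group_def)
  \<comment> \<open>As a permutative rule this sorts the two translations of each entry, so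
    simplification closes \<open>braid\<close>.\<close>
  have translations_commute: "x \<otimes>\<^bsub>A i\<^esub> g \<otimes>\<^bsub>A i\<^esub> h = x \<otimes>\<^bsub>A i\<^esub> h \<otimes>\<^bsub>A i\<^esub> g"
    if "i \<in> I" "x \<in> carrier (A i)" "g \<in> carrier (A i)" "h \<in> carrier (A i)" for i x g h
  proof -
    interpret comm_group "A i" using assms(2) that(1) .
    show ?thesis using that by (simp add: m_ac)
  qed
  have braid: "(id_times ?r \<circ> times_id ?r \<circ> id_times ?r) t
      = (times_id ?r \<circ> id_times ?r \<circ> times_id ?r) t" if "t \<in> ?X \<times> ?X \<times> ?X" for t
    using that assms(3,4)
    by (auto simp: union_carrier_def ybe_map_def id_times_def times_id_def
        union_sigma_def union_tau_def translations_commute)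
  have "?X \<noteq> {}"
    using assms(1) grp by (auto simp: union_carrier_def dest: group.is_monoid monoid.one_closed)
  then show "solution ?X (union_sigma A c) (union_tau A d)"
    using braid bij_betw_union_sigma[of I A c, OF grp assms(3)]
      bij_betw_union_sigma[of I A d, OF grp assms(4)]
      bij_betw_ybe_map_union[of I A c d, OF grp assms(3,4)]
    by (simp add: solution_def Let_def union_tau_eq_union_sigma)
  \<comment> \<open>On each side the subscript has the index of \<open>y\<close>.\<close>
  show "two_reductive ?X (union_sigma A c) (union_tau A d)"
    by (auto simp: two_reductive_def union_sigma_def union_tau_def)
qed

end
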